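(* Let $\Gamma$ be the zero-sum stochastic game with compact action sets described in the context, and let $v_\lambda(1)$ be the value of its $\lambda$-discounted game with initial state $1$. Then $(v_\lambda(1))$ does not converge when $\lambda\to0$.
   Context: The game has state space $K=\{1^*,1,0^*,0\}$ and compact action sets $I=[0,1]$ for Player 1 and $J=\{0\}\cup\{4^{-m}: m\in\mathbb{N}\}$ for Player 2, where $\mathbb{N}=\{0,1,2,\dots\}$. Both players observe the current state and all past states and actions. At each stage $m\ge1$, in state $k_m$, the players simultaneously and independently choose $x_m\in I$, $y_m\in J$; the stage payoff $g_m$ is $1$ if $k_m\in\{1,1^*\}$ and $0$ if $k_m\in\{0,0^*\}$; the next state is drawn from $q(k_m,x_m,y_m)$, where $1^*$ and $0^*$ are absorbing and $$q(1,x,y)=(1-y)\cdot 1+(y-y^2)\cdot 0+y^2\cdot 1^*,\qquad q(0,x,y)=(1-x)\cdot 0+(x-x^2)\cdot 1+x^2\cdot 0^*$$ (the notation $\sum_k\alpha_k\cdot k$ denotes the probability distribution on states giving weight $\alpha_k$ to state $k$). For $\lambda\in(0,1]$ the $\lambda$-discounted game has payoff $\mathbb{E}\big(\sum_{m\ge1}\lambda(1-\lambda)^{m-1}g_m\big)$, maximized by Player 1 and minimized by Player 2, over behavior strategies (measurable maps from finite histories to probability distributions on the action set); $v_\lambda(k)$ denotes its value when the initial state is $k$. *)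

theory Defs
  imports "HOL-Probability.Probability"
begin

datatype state = OneStar | One | ZeroStar | Zero

definition I1 :: "real set" where
  "I1 = {0..1}"

definition J2 :: "real set" where
  "J2 = {0} \<union> range (\<lambda>m::nat. 1 / 4 ^ m)"

fun stage_payoff :: "state \<Rightarrow> real" where
  "stage_payoff OneStar = 1"
| "stage_payoff One = 1"
| "stage_payoff ZeroStar = 0"
| "stage_payoff Zero = 0"

fun trans_weight :: "state \<Rightarrow> real \<Rightarrow> real \<Rightarrow> state \<Rightarrow> real" where
  "trans_weight OneStar x y k' = (if k' = OneStar then 1 else 0)"
| "trans_weight ZeroStar x y k' = (if k' = ZeroStar then 1 else 0)"
| "trans_weight One x y k' =
     (case k' of One \<Rightarrow> 1 - y | Zero \<Rightarrow> y - y\<^sup>2 | OneStar \<Rightarrow> y\<^sup>2 | ZeroStar \<Rightarrow> 0)"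
| "trans_weight Zero x y k' =
     (case k' of Zero \<Rightarrow> 1 - x | One \<Rightarrow> x - x\<^sup>2 | ZeroStar \<Rightarrow> x\<^sup>2 | OneStar \<Rightarrow> 0)"

definition transition :: "state \<Rightarrow> real \<Rightarrow> real \<Rightarrow> state measure" where
  "transition k x y = point_measure UNIV (\<lambda>k'. ennreal (trans_weight k x y k'))"

abbreviation state_space :: "state measure" where
  "state_space \<equiv> count_space UNIV"

abbreviation action_space :: "real set \<Rightarrow> real measure" where
  "action_space A \<equiv> restrict_space borel A"

definition stage_space :: "(state \<times> real \<times> real) measure" where
  "stage_space = state_space \<Otimes>\<^sub>M action_space I1 \<Otimes>\<^sub>M action_space J2"

(* Stages are numbered from 0.  What the players know when they act at stage n:
   the triples (state, action of Player 1, action of Player 2) of the stages i < n,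
   and the current state. *)
type_synonym history = "(nat \<Rightarrow> state \<times> real \<times> real) \<times> state"

definition history_space :: "nat \<Rightarrow> history measure" where
  "history_space n = (\<Pi>\<^sub>M i\<in>{0..<n}. stage_space) \<Otimes>\<^sub>M state_space"

type_synonym strategy = "nat \<Rightarrow> history \<Rightarrow> real measure"

definition behavior_strategies :: "real set \<Rightarrow> strategy set" where
  "behavior_strategies A =
     {\<sigma>. \<forall>n. \<sigma> n \<in> history_space n \<rightarrow>\<^sub>M prob_algebra (action_space A)}"

(* Conditional law of the stage-n triple given the triples of the stages i < n. *)
definition next_state :: "state \<Rightarrow> nat \<Rightarrow> (nat \<Rightarrow> state \<times> real \<times> real) \<Rightarrow> state measure" where
  "next_state k\<^sub>0 n h =
     (case n of 0 \<Rightarrow> return state_space k\<^sub>0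
      | Suc m \<Rightarrow> (case h m of (k, x, y) \<Rightarrow> transition k x y))"

definition stage_kernel ::
  "strategy \<Rightarrow> strategy \<Rightarrow> state \<Rightarrow> nat \<Rightarrow> (nat \<Rightarrow> state \<times> real \<times> real)
     \<Rightarrow> (state \<times> real \<times> real) measure" where
  "stage_kernel \<sigma> \<tau> k\<^sub>0 n h =
     next_state k\<^sub>0 n h \<bind> (\<lambda>k.
     \<sigma> n (h, k) \<bind> (\<lambda>x.
     \<tau> n (h, k) \<bind> (\<lambda>y.
     return stage_space (k, x, y))))"

(* The law on infinite plays given by the Ionescu-Tulcea theorem: this is the constant
   PF.lim of the locale Ionescu_Tulcea, whose assumptions are verified below. *)
definition play_measure ::
  "strategy \<Rightarrow> strategy \<Rightarrow> state \<Rightarrow> (nat \<Rightarrow> state \<times> real \<times> real) measure" where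
  "play_measure \<sigma> \<tau> k\<^sub>0 =
     projective_family.lim UNIV
       (Ionescu_Tulcea.CI (stage_kernel \<sigma> \<tau> k\<^sub>0) (\<lambda>_. stage_space)) (\<lambda>_. stage_space)"

(* Since stages start at 0, the weight of stage n is \<lambda>(1 - \<lambda>)^n. *)
definition discounted_payoff :: "real \<Rightarrow> state \<Rightarrow> strategy \<Rightarrow> strategy \<Rightarrow> real" where
  "discounted_payoff l k\<^sub>0 \<sigma> \<tau> =
     (\<integral>\<omega>. (\<Sum>n. l * (1 - l) ^ n * stage_payoff (fst (\<omega> n))) \<partial>play_measure \<sigma> \<tau> k\<^sub>0)"

(* Both strategy sets are nonempty and, for 0 < l \<le> 1, all payoffs lie in [0, 1],
   so the real-valued SUP and INF are the intended ones. *)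
definition is_value :: "real \<Rightarrow> state \<Rightarrow> real \<Rightarrow> bool" where
  "is_value l k v \<longleftrightarrow>
     v = (SUP \<sigma>\<in>behavior_strategies I1. INF \<tau>\<in>behavior_strategies J2. discounted_payoff l k \<sigma> \<tau>) \<and>
     v = (INF \<tau>\<in>behavior_strategies J2. SUP \<sigma>\<in>behavior_strategies I1. discounted_payoff l k \<sigma> \<tau>)"

definition game_value :: "real \<Rightarrow> state \<Rightarrow> real" where
  "game_value l k = (THE v. is_value l k v)"


lemma UNIV_state: "(UNIV :: state set) = {OneStar, One, ZeroStar, Zero}"
  using state.exhaust by auto

lemma finite_UNIV_state: "finite (UNIV :: state set)"
  by (simp add: UNIV_state)

lemma I1_bounds: "x \<in> I1 \<Longrightarrow> 0 \<le> x \<and> x \<le> 1"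
  by (simp add: I1_def)

lemma J2_bounds: "y \<in> J2 \<Longrightarrow> 0 \<le> y \<and> y \<le> 1"
  by (auto simp: J2_def divide_simps)

lemma trans_weight_nonneg:
  assumes "x \<in> I1" "y \<in> J2"
  shows "0 \<le> trans_weight k x y k'"
  using I1_bounds[OF assms(1)] J2_bounds[OF assms(2)] power_decreasing[of 1 2 x] power_decreasing[of 1 2 y]
  by (cases k; cases k') auto

lemma prob_space_transition:
  assumes "x \<in> I1" "y \<in> J2"
  shows "prob_space (transition k x y)"
proof
  have "emeasure (transition k x y) (space (transition k x y)) =
      (\<Sum>k'\<in>UNIV. ennreal (trans_weight k x y k'))"
    unfolding transition_def
    by (simp add: space_point_measure emeasure_point_measure_finite finite_UNIV_state)
  also have "\<dots> = ennreal (\<Sum>k'\<in>UNIV. trans_weight k x y k')"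
    by (intro sum_ennreal) (simp add: trans_weight_nonneg[OF assms])
  also have "(\<Sum>k'\<in>UNIV. trans_weight k x y k') = 1"
    by (cases k) (simp_all add: UNIV_state)
  finally show "emeasure (transition k x y) (space (transition k x y)) = 1" by simp
qed

lemma measurable_trans_weight:
  "(\<lambda>(k, x, y). trans_weight k x y k') \<in> borel_measurable stage_space"
proof -
  have *: "(\<lambda>(k, z). trans_weight k (fst z) (snd z) k')
      \<in> borel_measurable (state_space \<Otimes>\<^sub>M (action_space I1 \<Otimes>\<^sub>M action_space J2))"
  proof (rule measurable_pair_measure_countable1)
    show "countable (UNIV :: state set)"
      by (simp add: finite_UNIV_state countable_finite)
    fix k :: state
    have [measurable]: "id \<in> borel_measurable (action_space A)" for A
      by (simp add: measurable_restrict_space1)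
    have [measurable]: "fst \<in> borel_measurable (action_space I1 \<Otimes>\<^sub>M action_space J2)"
      using measurable_compose[OF measurable_fst, of id "action_space I1" borel "action_space J2"]
      by (simp add: comp_def id_def measurable_restrict_space1)
    have [measurable]: "snd \<in> borel_measurable (action_space I1 \<Otimes>\<^sub>M action_space J2)"
      using measurable_compose[OF measurable_snd, of id "action_space J2" borel "action_space I1"]
      by (simp add: comp_def id_def measurable_restrict_space1)
    show "(\<lambda>z. case (k, z) of (k, z) \<Rightarrow> trans_weight k (fst z) (snd z) k')
        \<in> borel_measurable (action_space I1 \<Otimes>\<^sub>M action_space J2)"
      by (cases k; cases k') simp_all
  qed
  then show ?thesis
    by (simp add: stage_space_def case_prod_beta')
qed

lemma measurable_transition:
  "(\<lambda>(k, x, y). transition k x y) \<in> stage_space \<rightarrow>\<^sub>M prob_algebra state_space"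
proof (rule measurable_prob_algebraI)
  fix s assume s: "s \<in> space stage_space"
  then show "prob_space (case s of (k, x, y) \<Rightarrow> transition k x y)"
    by (auto simp: stage_space_def space_pair_measure space_restrict_space prob_space_transition)
next
  show "(\<lambda>(k, x, y). transition k x y) \<in> stage_space \<rightarrow>\<^sub>M subprob_algebra state_space"
  proof (rule measurable_subprob_algebra)
    fix s assume s: "s \<in> space stage_space"
    then show "subprob_space (case s of (k, x, y) \<Rightarrow> transition k x y)"
      by (auto simp: stage_space_def space_pair_measure space_restrict_space
            prob_space_transition prob_space_imp_subprob_space)
    show "sets (case s of (k, x, y) \<Rightarrow> transition k x y) = sets state_space"
      by (auto simp: transition_def sets_point_measure split: prod.split)
  next
    fix A :: "state set"
    have "(\<lambda>s. \<Sum>k'\<in>A. ennreal ((\<lambda>(k, x, y). trans_weight k x y k') s))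
        \<in> borel_measurable stage_space"
      by (intro borel_measurable_sum measurable_compose[OF measurable_trans_weight measurable_ennreal])
    then show "(\<lambda>s. emeasure (case s of (k, x, y) \<Rightarrow> transition k x y) A)
        \<in> borel_measurable stage_space"
      by (simp add: transition_def case_prod_beta' emeasure_point_measure_finite finite_UNIV_state)
  qed
qed

lemma measurable_next_state:
  "next_state k\<^sub>0 n \<in> (\<Pi>\<^sub>M i\<in>{0..<n}. stage_space) \<rightarrow>\<^sub>M prob_algebra state_space"
proof (cases n)
  case 0
  have "return state_space k\<^sub>0 \<in> space (prob_algebra state_space)"
    by (auto simp: space_prob_algebra prob_space_return)
  then show ?thesis
    unfolding next_state_def 0 by simp
next
  case (Suc m)
  have "(\<lambda>h. h m) \<in> (\<Pi>\<^sub>M i\<in>{0..<n}. stage_space) \<rightarrow>\<^sub>M stage_space"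
    by (rule measurable_component_singleton) (simp add: Suc)
  from measurable_compose[OF this measurable_transition] show ?thesis
    unfolding next_state_def Suc by simp
qed

lemma measurable_stage_kernel:
  assumes \<sigma>: "\<sigma> \<in> behavior_strategies I1" and \<tau>: "\<tau> \<in> behavior_strategies J2"
  shows "stage_kernel \<sigma> \<tau> k\<^sub>0 n \<in> (\<Pi>\<^sub>M i\<in>{0..<n}. stage_space) \<rightarrow>\<^sub>M prob_algebra stage_space"
proof -
  have [measurable]:
    "\<sigma> n \<in> (\<Pi>\<^sub>M i\<in>{0..<n}. stage_space) \<Otimes>\<^sub>M state_space \<rightarrow>\<^sub>M prob_algebra (action_space I1)"
    "\<tau> n \<in> (\<Pi>\<^sub>M i\<in>{0..<n}. stage_space) \<Otimes>\<^sub>M state_space \<rightarrow>\<^sub>M prob_algebra (action_space J2)"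
    using \<sigma> \<tau> by (auto simp: behavior_strategies_def history_space_def)
  note measurable_next_state[measurable]
  have [measurable]: "return stage_space \<in> state_space \<Otimes>\<^sub>M action_space I1 \<Otimes>\<^sub>M action_space J2
      \<rightarrow>\<^sub>M prob_algebra stage_space"
    unfolding stage_space_def
    by (rule measurable_return_prob_space)
  show ?thesis
    unfolding stage_kernel_def[abs_def] by measurable
qed

lemma Ionescu_Tulcea_stage_kernel:
  assumes "\<sigma> \<in> behavior_strategies I1" "\<tau> \<in> behavior_strategies J2"
  shows "Ionescu_Tulcea (stage_kernel \<sigma> \<tau> k\<^sub>0) (\<lambda>_. stage_space)"
proof (rule Ionescu_Tulcea.intro)
  note K = measurable_stage_kernel[OF assms, of k\<^sub>0]
  show "stage_kernel \<sigma> \<tau> k\<^sub>0 i \<in> (\<Pi>\<^sub>M i\<in>{0..<i}. stage_space) \<rightarrow>\<^sub>M subprob_algebra stage_space" for i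
    by (rule measurable_prob_algebraD[OF K])
  show "prob_space (stage_kernel \<sigma> \<tau> k\<^sub>0 i x)"
    if "x \<in> space (\<Pi>\<^sub>M i\<in>{0..<i}. stage_space)" for i x
    using measurable_space[OF K that] by (simp add: space_prob_algebra)
qed

lemma behavior_strategies_nonempty:
  assumes "a \<in> A"
  shows "(\<lambda>_ _. return (action_space A) a) \<in> behavior_strategies A"
proof -
  have "return (action_space A) a \<in> space (prob_algebra (action_space A))"
    using assms by (auto simp: space_prob_algebra prob_space_return space_restrict_space)
  then show ?thesis
    by (simp add: behavior_strategies_def)
qed

end

theory Submission
  imports Defs
begin

text \<open>
  The transition out of \<^const>\<open>One\<close> depends only on the action of Player 2 and the transition out of
  \<^const>\<open>Zero\<close> only on the action of Player 1. The Shapley equations for the values $a$ at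
  \<^const>\<open>One\<close> and $b$ at \<^const>\<open>Zero\<close> are therefore a minimization over \<^const>\<open>J2\<close> and a
  maximization over \<^const>\<open>I1\<close>, attained by pure actions. They have a solution because they define
  a contraction with factor $1 - \lambda$ for the sup norm (\<open>shapley_solution_exists\<close>). Playing the
  two optimal actions at every stage is a saddle point among all behavior strategies, since along every
  play the solution can then be compared with the stage payoff plus its own expected continuation, and
  the comparison telescopes (\<open>subsolution_le_payoff\<close>, \<open>supersolution_ge_payoff\<close>). So the value exists
  and equals $a$ (\<open>is_value_if_shapley_solution\<close>).

  For the asymptotics, solving the maximization over $[0,1]$ explicitly gives
  $4 \lambda a b = (1 - \lambda)(a - b)^2$. If $a$ tends to $L$, then so does $b$, and the normalized gap
  $d = (a - b) / \sqrt\lambda$ tends to $2 L$. Writing Player 2's action as $z \sqrt\lambda$, the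
  equation at \<^const>\<open>One\<close> becomes
  $1 - a = (1 - \lambda) \max_z (z d - z^2 (1 - b))$, which in the limit reads
  $1 - L = \max_z (2 z L - z^2 (1 - L))$. Near $L = 1/2$ the best choice is $z = 1$. It is available
  when $\lambda = 16^{-m}$, and then $L \le 1/2$ (\<open>limit_le_half\<close>). When $\lambda = 4 \cdot 16^{-m}$,
  the gaps in \<^const>\<open>J2\<close> force $z \le 1/2$ or $z \ge 2$; Player 2 is then strictly worse off
  and $L > 1/2$ (\<open>limit_gt_half\<close>; in fact $L \ge 5/9$ there).
\<close>

section \<open>The Shapley equations\<close>

text \<open>
  The pair map is a contraction for the sup norm, whereas the metric of \<^typ>\<open>real \<times> real\<close> is Euclidean.
  Applying the one-dimensional Banach theorem twice avoids the mismatch: the fixed point in the first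
  coordinate is a nonexpansive function of the second.
\<close>
lemma coupled_fixed_point:
  fixes F G :: "real \<Rightarrow> real \<Rightarrow> real"
  assumes c: "0 \<le> c" "c < 1"
    and F: "\<And>a b a' b'. \<bar>F a b - F a' b'\<bar> \<le> c * max \<bar>a - a'\<bar> \<bar>b - b'\<bar>"
    and G: "\<And>a b a' b'. \<bar>G a b - G a' b'\<bar> \<le> c * max \<bar>a - a'\<bar> \<bar>b - b'\<bar>"
  obtains a b where "F a b = a" "G a b = b"
proof -
  have "\<exists>a. F a b = a" for b
    using banach_fix_type[OF c, of "\<lambda>a. F a b"] F[of _ b _ b] by (auto simp: dist_real_def)
  then obtain A where A: "\<And>b. F (A b) b = A b" by metis
  have A_le: "\<bar>A b - A b'\<bar> \<le> \<bar>b - b'\<bar>" for b b'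
  proof (rule ccontr)
    assume "\<not> ?thesis"
    then have less: "\<bar>b - b'\<bar> < \<bar>A b - A b'\<bar>" by simp
    with F[of "A b" b "A b'" b'] have "\<bar>A b - A b'\<bar> \<le> c * \<bar>A b - A b'\<bar>"
      by (simp add: A max_def)
    moreover have "c * \<bar>A b - A b'\<bar> < 1 * \<bar>A b - A b'\<bar>"
      using less c by (intro mult_strict_right_mono) auto
    ultimately show False by simp
  qed
  have "\<bar>G (A b) b - G (A b') b'\<bar> \<le> c * \<bar>b - b'\<bar>" for b b'
    using G[of "A b" b "A b'" b'] A_le[of b b'] by (simp add: max_def)
  then obtain b where "G (A b) b = b"
    using banach_fix_type[OF c, of "\<lambda>b. G (A b) b"] by (auto simp: dist_real_def)
  with A that show thesis by blast
qed

text \<open>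
  The payoff of the one-shot game at \<^const>\<open>One\<close> and at \<^const>\<open>Zero\<close> when the continuation values are
  $a$ at \<^const>\<open>One\<close> and $b$ at \<^const>\<open>Zero\<close>; each depends on the action of one player only.
\<close>
definition shapley_One :: "real \<Rightarrow> real \<Rightarrow> real \<Rightarrow> real \<Rightarrow> real" where
  "shapley_One l a b y = l + (1 - l) * ((1 - y) * a + (y - y\<^sup>2) * b + y\<^sup>2)"

definition shapley_Zero :: "real \<Rightarrow> real \<Rightarrow> real \<Rightarrow> real \<Rightarrow> real" where
  "shapley_Zero l a b x = (1 - l) * ((1 - x) * b + (x - x\<^sup>2) * a)"

definition shapley_solution :: "real \<Rightarrow> real \<Rightarrow> real \<Rightarrow> real \<Rightarrow> real \<Rightarrow> bool" where
  "shapley_solution l a b x y \<longleftrightarrow>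
     0 \<le> a \<and> a \<le> 1 \<and> 0 \<le> b \<and> b \<le> 1 \<and> x \<in> I1 \<and> y \<in> J2 \<and>
     shapley_One l a b y = a \<and> (\<forall>y'\<in>J2. a \<le> shapley_One l a b y') \<and>
     shapley_Zero l a b x = b \<and> (\<forall>x'\<in>I1. shapley_Zero l a b x' \<le> b)"

lemma compact_J2: "compact J2"
proof -
  have "(\<lambda>m::nat. 1 / 4 ^ m :: real) \<longlonglongrightarrow> 0"
    using LIMSEQ_realpow_zero[of "1/4::real"] by (simp add: power_one_over)
  from compact_sequence_with_limit[OF this] show ?thesis
    by (simp add: J2_def)
qed

text \<open>
  The transition weights to the two nonabsorbing states sum to at most one; this is what makes the
  one-shot payoffs nonexpansive before discounting.
\<close>
lemma subconvex_diff_le: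
  fixes p q :: real
  assumes "0 \<le> p" "0 \<le> q" "p + q \<le> 1"
  shows "p * u + q * v \<le> p * u' + q * v' + max \<bar>u - u'\<bar> \<bar>v - v'\<bar>"
proof -
  define m where "m = max \<bar>u - u'\<bar> \<bar>v - v'\<bar>"
  have "p * (u - u') \<le> p * m" "q * (v - v') \<le> q * m"
    using assms by (auto simp: m_def intro!: mult_left_mono)
  moreover have "(p + q) * m \<le> 1 * m"
    using assms(3) by (intro mult_right_mono) (auto simp: m_def)
  ultimately show ?thesis
    unfolding m_def[symmetric] by (simp add: algebra_simps)
qed

lemma shapley_One_diff_le:
  assumes l: "0 < l" "l \<le> 1" and y: "y \<in> J2"
  shows "shapley_One l a b y \<le> shapley_One l a' b' y + (1 - l) * max \<bar>a - a'\<bar> \<bar>b - b'\<bar>"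
proof -
  have "y\<^sup>2 \<le> y" "0 \<le> y\<^sup>2" "y \<le> 1"
    using J2_bounds[OF y] by (auto simp: power2_eq_square mult_left_le)
  then have "(1 - y) * a + (y - y\<^sup>2) * b \<le> (1 - y) * a' + (y - y\<^sup>2) * b' + max \<bar>a - a'\<bar> \<bar>b - b'\<bar>"
    by (intro subconvex_diff_le) auto
  from mult_left_mono[OF this, of "1 - l"] l show ?thesis
    by (simp add: shapley_One_def algebra_simps)
qed

lemma shapley_Zero_diff_le:
  assumes l: "0 < l" "l \<le> 1" and x: "x \<in> I1"
  shows "shapley_Zero l a b x \<le> shapley_Zero l a' b' x + (1 - l) * max \<bar>a - a'\<bar> \<bar>b - b'\<bar>"
proof -
  have "x\<^sup>2 \<le> x" "0 \<le> x\<^sup>2" "x \<le> 1"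
    using I1_bounds[OF x] by (auto simp: power2_eq_square mult_left_le)
  then have "(x - x\<^sup>2) * a + (1 - x) * b \<le> (x - x\<^sup>2) * a' + (1 - x) * b' + max \<bar>a - a'\<bar> \<bar>b - b'\<bar>"
    by (intro subconvex_diff_le) auto
  from mult_left_mono[OF this, of "1 - l"] l show ?thesis
    by (simp add: shapley_Zero_def algebra_simps)
qed

lemma shapley_solution_exists:
  assumes l: "0 < l" "l \<le> 1"
  obtains a b x y where "shapley_solution l a b x y"
proof -
  have "\<exists>y\<in>J2. \<forall>y'\<in>J2. shapley_One l a b y \<le> shapley_One l a b y'" for a b
    unfolding shapley_One_def
    by (intro continuous_attains_inf compact_J2 continuous_intros) (auto simp: J2_def)
  then obtain Y where Y: "\<And>a b. Y a b \<in> J2"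
    "\<And>a b y'. y' \<in> J2 \<Longrightarrow> shapley_One l a b (Y a b) \<le> shapley_One l a b y'"
    by metis
  have "\<exists>x\<in>I1. \<forall>x'\<in>I1. shapley_Zero l a b x' \<le> shapley_Zero l a b x" for a b
    unfolding shapley_Zero_def I1_def
    by (intro continuous_attains_sup compact_Icc continuous_intros) auto
  then obtain X where X: "\<And>a b. X a b \<in> I1"
    "\<And>a b x'. x' \<in> I1 \<Longrightarrow> shapley_Zero l a b x' \<le> shapley_Zero l a b (X a b)"
    by metis
  have FY: "shapley_One l a b (Y a b) - shapley_One l a' b' (Y a' b') \<le> (1 - l) * max \<bar>a - a'\<bar> \<bar>b - b'\<bar>"
    for a b a' b'
    using Y(2)[OF Y(1)[of a' b'], of a b] shapley_One_diff_le[OF l Y(1)[of a' b'], of a b a' b'] by simp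
  have FX: "shapley_Zero l a b (X a b) - shapley_Zero l a' b' (X a' b') \<le> (1 - l) * max \<bar>a - a'\<bar> \<bar>b - b'\<bar>"
    for a b a' b'
    using X(2)[OF X(1)[of a b], of a' b'] shapley_Zero_diff_le[OF l X(1)[of a b], of a b a' b'] by simp
  obtain a b where a: "shapley_One l a b (Y a b) = a" and b: "shapley_Zero l a b (X a b) = b"
  proof (rule coupled_fixed_point[of "1 - l" "\<lambda>a b. shapley_One l a b (Y a b)" "\<lambda>a b. shapley_Zero l a b (X a b)"])
    show "\<bar>shapley_One l a b (Y a b) - shapley_One l a' b' (Y a' b')\<bar> \<le> (1 - l) * max \<bar>a - a'\<bar> \<bar>b - b'\<bar>"
      for a b a' b'
      using FY[of a b a' b'] FY[of a' b' a b] by (simp add: abs_minus_commute abs_le_iff)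
    show "\<bar>shapley_Zero l a b (X a b) - shapley_Zero l a' b' (X a' b')\<bar> \<le> (1 - l) * max \<bar>a - a'\<bar> \<bar>b - b'\<bar>"
      for a b a' b'
      using FX[of a b a' b'] FX[of a' b' a b] by (simp add: abs_minus_commute abs_le_iff)
  qed (use l in auto)
  define x where "x = X a b"
  define y where "y = Y a b"
  have x: "0 \<le> x" "x \<le> 1" "x\<^sup>2 \<le> x" and y: "0 \<le> y" "y \<le> 1" "y\<^sup>2 \<le> y"
    using I1_bounds[OF X(1)[of a b]] J2_bounds[OF Y(1)[of a b]]
    by (auto simp: x_def y_def power2_eq_square mult_left_le)
  \<comment> \<open>The fixed point is not confined to the unit square by construction; the bounds come from the
    equations: the action 0 gives $b \ge 0$ and $a \le 1$, the
  optimal actions give the other two.\<close>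
  have b0: "0 \<le> b"
  proof -
    have "shapley_Zero l a b 0 \<le> b"
      using X(2)[of 0 a b] b by (simp add: I1_def)
    then have "0 \<le> l * b" by (simp add: shapley_Zero_def algebra_simps)
    with l show ?thesis by (simp add: zero_le_mult_iff)
  qed
  have a1: "a \<le> 1"
  proof -
    have "a \<le> shapley_One l a b 0"
      using Y(2)[of 0 a b] a by (simp add: J2_def)
    then have "l * a \<le> l * 1" by (simp add: shapley_One_def algebra_simps)
    with l show ?thesis by (simp only: mult_le_cancel_left_pos)
  qed
  have a0: "0 \<le> a"
  proof -
    have "a * (l + (1 - l) * y) = l + (1 - l) * ((y - y\<^sup>2) * b + y\<^sup>2)"
      using a by (simp add: shapley_One_def y_def[symmetric] algebra_simps)
    also have "\<dots> \<ge> 0" using l y b0 by (intro add_nonneg_nonneg mult_nonneg_nonneg) auto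
    finally have "0 \<le> a * (l + (1 - l) * y)" .
    moreover have "0 < l + (1 - l) * y" using l y by (intro add_pos_nonneg) auto
    ultimately show ?thesis by (simp add: zero_le_mult_iff)
  qed
  have b1: "b \<le> 1"
  proof -
    have "b * (l + (1 - l) * x) = (1 - l) * ((x - x\<^sup>2) * a)"
      using b by (simp add: shapley_Zero_def x_def[symmetric] algebra_simps)
    also have "\<dots> \<le> (1 - l) * (x * 1)"
      using l x a0 a1 by (intro mult_left_mono mult_mono) auto
    also have "\<dots> \<le> 1 * (l + (1 - l) * x)" using l by simp
    finally have "b * (l + (1 - l) * x) \<le> 1 * (l + (1 - l) * x)" .
    moreover have "0 < l + (1 - l) * x" using l x by (intro add_pos_nonneg) auto
    ultimately show ?thesis by (simp only: mult_le_cancel_right_pos)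
  qed
  have "shapley_solution l a b x y"
    using a b a0 a1 b0 b1 X Y unfolding shapley_solution_def x_def y_def by metis
  with that show thesis .
qed

text \<open>
  Since $a > 0$, the concave quadratic $x(a - b) - x^2 a$ has its maximum $(a - b)^2 / (4 a)$ at
  $x = (a - b) / (2 a)$, and this point lies in $[0,1]$ once $b \le a$ is known. If $b > a$ held,
  switching at \<^const>\<open>Zero\<close> would be useless, so $b$ would be $0 \le a$.
\<close>
lemma shapley_solution_quadratic:
  assumes l: "0 < l" "l \<le> 1" and S: "shapley_solution l a b x y"
  shows "b \<le> a" and "4 * l * a * b = (1 - l) * (a - b)\<^sup>2"
proof -
  have ab: "0 \<le> a" "a \<le> 1" "0 \<le> b" "b \<le> 1" and x: "0 \<le> x" "x \<le> 1"
    using S I1_bounds by (auto simp: shapley_solution_def)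
  have eqx: "l * b = (1 - l) * (x * (a - b) - x\<^sup>2 * a)"
    using S by (simp add: shapley_solution_def shapley_Zero_def algebra_simps)
  have lex: "(1 - l) * (x' * (a - b) - x'\<^sup>2 * a) \<le> l * b" if "x' \<in> I1" for x'
  proof -
    have "shapley_Zero l a b x' \<le> b" using S that by (simp add: shapley_solution_def)
    then show ?thesis by (simp add: shapley_Zero_def algebra_simps)
  qed
  have eqy: "l * (1 - a) = (1 - l) * (y * (a - b) - y\<^sup>2 * (1 - b))"
    using S by (simp add: shapley_solution_def shapley_One_def algebra_simps)
  show ba: "b \<le> a"
  proof (rule ccontr)
    assume "\<not> b \<le> a"
    then have "x * (a - b) \<le> 0" "0 \<le> x\<^sup>2 * a" "0 < b"
      using ab x by (auto intro: mult_nonneg_nonpos)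
    then have "x * (a - b) - x\<^sup>2 * a \<le> 0" "0 < l * b"
      using l by auto
    moreover from this(1) have "(1 - l) * (x * (a - b) - x\<^sup>2 * a) \<le> 0"
      using l by (intro mult_nonneg_nonpos) auto
    ultimately show False using eqx by simp
  qed
  have a_pos: "0 < a"
  proof (rule ccontr)
    assume "\<not> 0 < a"
    with ab ba have "a = 0" "b = 0" by auto
    with eqy have "l = - ((1 - l) * y\<^sup>2)" by simp
    moreover have "0 \<le> (1 - l) * y\<^sup>2" using l by simp
    ultimately show False using l by linarith
  qed
  have le: "4 * a * (x * (a - b) - x\<^sup>2 * a) \<le> (a - b)\<^sup>2"
    using zero_le_power2[of "(a - b) - 2 * a * x"] by (simp add: power2_eq_square algebra_simps)
  have "4 * l * a * b = (1 - l) * (4 * a * (x * (a - b) - x\<^sup>2 * a))"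
    using arg_cong[OF eqx, of "\<lambda>t. 4 * a * t"] by (simp only: mult_ac)
  also have "\<dots> \<le> (1 - l) * (a - b)\<^sup>2"
    using le l by (intro mult_left_mono) auto
  finally have "4 * l * a * b \<le> (1 - l) * (a - b)\<^sup>2" .
  moreover
  define x' where "x' = (a - b) / (2 * a)"
  have "x' \<in> I1" using ab ba a_pos by (simp add: x'_def I1_def field_simps)
  from mult_left_mono[OF lex[OF this], of "4 * a"] a_pos
  have "(1 - l) * (4 * a * (x' * (a - b) - x'\<^sup>2 * a)) \<le> 4 * l * a * b"
    by (simp add: algebra_simps)
  moreover have "4 * a * (x' * (a - b) - x'\<^sup>2 * a) = (a - b)\<^sup>2"
    using a_pos by (simp add: x'_def power2_eq_square field_simps)
  ultimately show "4 * l * a * b = (1 - l) * (a - b)\<^sup>2" by simp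
qed

section \<open>Law of the play\<close>

lemma (in Ionescu_Tulcea) nn_integral_lim_restrict:
  assumes F: "F \<in> borel_measurable (PiM {0..<n} M)"
  shows "(\<integral>\<^sup>+\<omega>. F (restrict \<omega> {0..<n}) \<partial>PF.lim) = (\<integral>\<^sup>+\<omega>. F \<omega> \<partial>C 0 n (\<lambda>_. undefined))"
proof -
  have sets: "sets (C 0 n (\<lambda>_. undefined)) = sets (PiM {0..<n} M)"
    by (simp add: sets_C)
  have "CI {0..<n} = C 0 n (\<lambda>_. undefined)"
  proof (rule measure_eqI)
    fix X assume "X \<in> sets (CI {0..<n})"
    then have X: "X \<in> sets (PiM {0..<n} M)"
      by (simp add: CI_def)
    have "PF.emb {0..<n} {0..<n} X = X"
      using X sets.sets_into_space[OF X] by (intro prod_emb_id) (auto simp: space_PiM)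
    with emeasure_CI[OF subset_refl X]
    show "emeasure (CI {0..<n}) X = emeasure (C 0 n (\<lambda>_. undefined)) X" by simp
  qed (simp add: CI_def sets)
  then have "(\<integral>\<^sup>+\<omega>. F \<omega> \<partial>C 0 n (\<lambda>_. undefined))
      = (\<integral>\<^sup>+\<omega>. F \<omega> \<partial>distr PF.lim (PiM {0..<n} M) (\<lambda>x. restrict x {0..<n}))"
    by (simp add: distr_lim)
  also have "\<dots> = (\<integral>\<^sup>+\<omega>. F (restrict \<omega> {0..<n}) \<partial>PF.lim)"
    using F by (intro nn_integral_distr)
      (auto simp: measurable_cong_sets[OF PF.sets_lim refl] intro!: measurable_restrict_subset)
  finally show ?thesis ..
qed

text \<open>
  All that is needed about the infinite play: the law of a coordinate is the kernel averaged over the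
  past. Higher-order correlations never enter.
\<close>
lemma (in Ionescu_Tulcea) nn_integral_lim_component:
  assumes f: "f \<in> borel_measurable (M n)"
  shows "(\<integral>\<^sup>+\<omega>. f (\<omega> n) \<partial>PF.lim) = (\<integral>\<^sup>+\<omega>. (\<integral>\<^sup>+s. f s \<partial>P n (restrict \<omega> {0..<n})) \<partial>PF.lim)"
proof -
  have F: "(\<lambda>\<omega>. f (\<omega> n)) \<in> borel_measurable (PiM {0..<Suc n} M)"
    by (rule measurable_compose[OF measurable_component_singleton[of n "{0..<Suc n}" M] f]) simp
  have G: "(\<lambda>\<omega>. \<integral>\<^sup>+s. f s \<partial>P n \<omega>) \<in> borel_measurable (PiM {0..<n} M)"
    by (rule measurable_compose[OF P nn_integral_measurable_subprob_algebra[OF f]])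
  have "(\<integral>\<^sup>+\<omega>. f (\<omega> n) \<partial>PF.lim) = (\<integral>\<^sup>+\<omega>. f (\<omega> n) \<partial>C 0 (Suc n) (\<lambda>_. undefined))"
    using nn_integral_lim_restrict[OF F] by simp
  also have "\<dots> = (\<integral>\<^sup>+\<omega>. \<integral>\<^sup>+\<omega>'. f (\<omega>' n) \<partial>eP n \<omega> \<partial>C 0 n (\<lambda>_. undefined))"
    using F measurable_eP[of n]
    by (simp, subst nn_integral_bind[where B="PiM {0..<Suc n} M"])
       (auto simp: measurable_cong_sets[OF sets_C refl])
  also have "\<dots> = (\<integral>\<^sup>+\<omega>. \<integral>\<^sup>+s. f s \<partial>P n \<omega> \<partial>C 0 n (\<lambda>_. undefined))"
    by (intro nn_integral_cong) (simp add: space_C nn_integral_eP[OF _ F])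
  also have "\<dots> = (\<integral>\<^sup>+\<omega>. (\<integral>\<^sup>+s. f s \<partial>P n (restrict \<omega> {0..<n})) \<partial>PF.lim)"
    by (rule nn_integral_lim_restrict[OF G, symmetric])
  finally show ?thesis .
qed

lemma strategy_in_prob_algebra:
  assumes "\<sigma> \<in> behavior_strategies I1" "\<tau> \<in> behavior_strategies J2"
    and h: "h \<in> space (\<Pi>\<^sub>M i\<in>{0..<n}. stage_space)"
  shows "\<sigma> n (h, k) \<in> space (prob_algebra (action_space I1))"
    and "\<tau> n (h, k) \<in> space (prob_algebra (action_space J2))"
proof -
  have hk: "(h, k) \<in> space (history_space n)"
    using h by (simp add: history_space_def space_pair_measure)
  show "\<sigma> n (h, k) \<in> space (prob_algebra (action_space I1))"
    "\<tau> n (h, k) \<in> space (prob_algebra (action_space J2))"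
    using assms(1,2) by (auto simp: behavior_strategies_def intro: measurable_space[OF _ hk])
qed

lemma nn_integral_stage_kernel:
  assumes \<sigma>: "\<sigma> \<in> behavior_strategies I1" and \<tau>: "\<tau> \<in> behavior_strategies J2"
    and h: "h \<in> space (\<Pi>\<^sub>M i\<in>{0..<n}. stage_space)"
    and f[measurable]: "f \<in> borel_measurable stage_space"
  shows "(\<integral>\<^sup>+s. f s \<partial>stage_kernel \<sigma> \<tau> k\<^sub>0 n h) =
    (\<integral>\<^sup>+k. \<integral>\<^sup>+x. \<integral>\<^sup>+y. f (k, x, y) \<partial>\<tau> n (h, k) \<partial>\<sigma> n (h, k) \<partial>next_state k\<^sub>0 n h)"
proof -
  note prob = strategy_in_prob_algebra[OF \<sigma> \<tau> h]
  have nxt: "next_state k\<^sub>0 n h \<in> space (prob_algebra state_space)"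
    by (rule measurable_space[OF measurable_next_state h])
  have [measurable_cong]: "sets (\<sigma> n (h, k)) = sets (action_space I1)"
    "sets (\<tau> n (h, k)) = sets (action_space J2)" "sets (next_state k\<^sub>0 n h) = sets state_space" for k
    using prob nxt by (auto simp: space_prob_algebra)
  have [measurable]: "return stage_space \<in> state_space \<Otimes>\<^sub>M action_space I1 \<Otimes>\<^sub>M action_space J2
      \<rightarrow>\<^sub>M prob_algebra stage_space"
    unfolding stage_space_def by (rule measurable_return_prob_space)
  have [measurable]: "(\<lambda>_. \<sigma> n (h, k)) \<in> N \<rightarrow>\<^sub>M prob_algebra (action_space I1)"
    "(\<lambda>_. \<tau> n (h, k)) \<in> N \<rightarrow>\<^sub>M prob_algebra (action_space J2)" for k and N :: "'b measure"
    using prob by auto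
  have mx: "(\<lambda>x. \<tau> n (h, k) \<bind> (\<lambda>y. return stage_space (k, x, y)))
      \<in> \<sigma> n (h, k) \<rightarrow>\<^sub>M subprob_algebra stage_space" for k
    by (rule measurable_prob_algebraD) measurable
  have my: "(\<lambda>y. return stage_space (k, x, y)) \<in> \<tau> n (h, k) \<rightarrow>\<^sub>M subprob_algebra stage_space"
    if [measurable]: "x \<in> space (action_space I1)" for k x
    by (rule measurable_prob_algebraD) (use that in measurable)
  have mk: "(\<lambda>k. \<sigma> n (h, k) \<bind> (\<lambda>x. \<tau> n (h, k) \<bind> (\<lambda>y. return stage_space (k, x, y))))
      \<in> next_state k\<^sub>0 n h \<rightarrow>\<^sub>M subprob_algebra stage_space"
  proof (rule measurable_prob_algebraD)
    have "\<sigma> n (h, k) \<bind> (\<lambda>x. \<tau> n (h, k) \<bind> (\<lambda>y. return stage_space (k, x, y)))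
        \<in> space (prob_algebra stage_space)" for k
    proof -
      have "(\<lambda>_. \<sigma> n (h, k) \<bind> (\<lambda>x. \<tau> n (h, k) \<bind> (\<lambda>y. return stage_space (k, x, y))))
        \<in> state_space \<rightarrow>\<^sub>M prob_algebra stage_space"
        by measurable
      from measurable_space[OF this, of k] show ?thesis by simp
    qed
    then show "(\<lambda>k. \<sigma> n (h, k) \<bind> (\<lambda>x. \<tau> n (h, k) \<bind> (\<lambda>y. return stage_space (k, x, y))))
      \<in> next_state k\<^sub>0 n h \<rightarrow>\<^sub>M prob_algebra stage_space"
      by (subst measurable_cong_sets[OF \<open>sets (next_state k\<^sub>0 n h) = sets state_space\<close> refl]) simp
  qed
  show ?thesis
    unfolding stage_kernel_def
  proof (subst nn_integral_bind[OF f mk], intro nn_integral_cong, subst nn_integral_bind[OF f mx],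
      intro nn_integral_cong)
    fix k x assume "x \<in> space (\<sigma> n (h, k))"
    then have x: "x \<in> space (action_space I1)"
      using sets_eq_imp_space_eq[OF \<open>sets (\<sigma> n (h, k)) = sets (action_space I1)\<close>] by simp
    have "(\<integral>\<^sup>+s. f s \<partial>return stage_space (k, x, y)) = f (k, x, y)"
      if "y \<in> space (\<tau> n (h, k))" for y
      using x that sets_eq_imp_space_eq[OF \<open>sets (\<tau> n (h, k)) = sets (action_space J2)\<close>]
      by (intro nn_integral_return f) (simp add: stage_space_def space_pair_measure)
    then show "(\<integral>\<^sup>+s. f s \<partial>(\<tau> n (h, k) \<bind> (\<lambda>y. return stage_space (k, x, y)))) =
        (\<integral>\<^sup>+y. f (k, x, y) \<partial>\<tau> n (h, k))"
      by (subst nn_integral_bind[OF f my[OF x]]) (intro nn_integral_cong)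
  qed
qed

text \<open>
  The inequality multiplied by $(1 - l)^n$ bounds $(1 - l)^n u_n - (1 - l)^{n+1} u_{n+1}$, and these
  differences sum to $u_0$, the boundary term vanishing because $u$ is bounded.
\<close>
lemma discounted_telescope_le:
  fixes u e :: "nat \<Rightarrow> real"
  assumes l: "0 < l" "l \<le> 1"
    and u: "\<And>n. \<bar>u n\<bar> \<le> B" and e: "\<And>n. \<bar>e n\<bar> \<le> B"
    and step: "\<And>n. u n \<le> l * e n + (1 - l) * u (Suc n)"
  shows "summable (\<lambda>n. l * (1 - l) ^ n * e n)" and "u 0 \<le> (\<Sum>n. l * (1 - l) ^ n * e n)"
proof -
  have geo: "summable (\<lambda>n. l * (1 - l) ^ n * B)"
    using l by (intro summable_mult summable_mult2 summable_geometric) auto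
  show sum: "summable (\<lambda>n. l * (1 - l) ^ n * e n)"
  proof (rule summable_comparison_test'[OF geo])
    show "norm (l * (1 - l) ^ n * e n) \<le> l * (1 - l) ^ n * B" for n
      using l mult_left_mono[OF e[of n], of "l * (1 - l) ^ n"] by (simp add: abs_mult)
  qed
  have "(\<lambda>n. (1 - l) ^ n * u n) \<longlonglongrightarrow> 0"
  proof (rule Lim_null_comparison)
    show "\<forall>\<^sub>F n in sequentially. norm ((1 - l) ^ n * u n) \<le> (1 - l) ^ n * B"
      using l u by (intro always_eventually allI) (simp add: abs_mult mult_left_mono)
    show "(\<lambda>n. (1 - l) ^ n * B) \<longlonglongrightarrow> 0"
      using l by (intro tendsto_mult_left_zero LIMSEQ_realpow_zero) auto
  qed
  from telescope_sums'[OF this]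
  have tele: "(\<lambda>n. (1 - l) ^ n * u n - (1 - l) ^ Suc n * u (Suc n)) sums u 0" by simp
  show "u 0 \<le> (\<Sum>n. l * (1 - l) ^ n * e n)"
  proof (rule sums_le[OF _ tele summable_sums[OF sum]])
    show "(1 - l) ^ n * u n - (1 - l) ^ Suc n * u (Suc n) \<le> l * (1 - l) ^ n * e n" for n
      using l mult_left_mono[OF step[of n], of "(1 - l) ^ n"] by (simp add: algebra_simps)
  qed
qed

lemma measurable_stage_coordinates [measurable]:
  "fst \<in> stage_space \<rightarrow>\<^sub>M state_space"
  "(\<lambda>t. fst (snd t)) \<in> borel_measurable stage_space"
  "(\<lambda>t. snd (snd t)) \<in> borel_measurable stage_space"
proof -
  have id: "(\<lambda>x. x) \<in> borel_measurable (action_space A)" for A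
    using measurable_restrict_space1[OF measurable_ident, of borel A] by (simp add: id_def)
  show "fst \<in> stage_space \<rightarrow>\<^sub>M state_space"
    "(\<lambda>t. fst (snd t)) \<in> borel_measurable stage_space"
    "(\<lambda>t. snd (snd t)) \<in> borel_measurable stage_space"
    unfolding stage_space_def
    using measurable_compose[OF measurable_snd measurable_compose[OF measurable_fst id]]
      measurable_compose[OF measurable_snd measurable_compose[OF measurable_snd id]]
    by auto
qed

lemma measurable_stage_state [measurable]:
  fixes w :: "state \<Rightarrow> 'a :: topological_space"
  shows "(\<lambda>t. w (fst t)) \<in> borel_measurable stage_space"
  by (rule measurable_compose[OF measurable_stage_coordinates(1)]) simp

lemma space_stage_space: "space stage_space = UNIV \<times> I1 \<times> J2"
  by (simp add: stage_space_def space_pair_measure space_restrict_space)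

definition continuation :: "(state \<Rightarrow> real) \<Rightarrow> state \<times> real \<times> real \<Rightarrow> real" where
  "continuation w = (\<lambda>(k, x, y). \<Sum>k'\<in>UNIV. trans_weight k x y k' * w k')"

lemma measurable_continuation [measurable]: "continuation w \<in> borel_measurable stage_space"
proof -
  have "(\<lambda>s. \<Sum>k'\<in>UNIV. (case s of (k, x, y) \<Rightarrow> trans_weight k x y k') * w k')
      \<in> borel_measurable stage_space"
    by (intro borel_measurable_sum borel_measurable_times measurable_trans_weight) simp
  then show ?thesis
    by (simp add: continuation_def case_prod_beta')
qed

lemma stage_payoff_bounds: "0 \<le> stage_payoff k" "stage_payoff k \<le> 1"
  by (cases k; simp)+

lemma continuation_bounds:
  assumes t: "t \<in> space stage_space" and w: "\<And>k. 0 \<le> w k" "\<And>k. w k \<le> 1"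
  shows "\<bar>continuation w t\<bar> \<le> 1"
proof -
  obtain k x y where t_eq: "t = (k, x, y)" by (cases t) auto
  have xy: "x \<in> I1" "y \<in> J2" using t by (auto simp: t_eq space_stage_space)
  have "continuation w t \<le> (\<Sum>k'\<in>UNIV. trans_weight k x y k' * 1)"
    unfolding t_eq continuation_def prod.case using w trans_weight_nonneg[OF xy]
    by (intro sum_mono mult_left_mono) auto
  also have "\<dots> = 1" by (cases k) (simp_all add: UNIV_state)
  finally have "continuation w t \<le> 1" .
  moreover have "0 \<le> continuation w t"
    unfolding t_eq continuation_def prod.case using w trans_weight_nonneg[OF xy] by (auto intro!: sum_nonneg)
  ultimately show ?thesis by simp
qed

context
  fixes \<sigma> \<tau> :: strategy and k\<^sub>0 :: state
  assumes \<sigma>: "\<sigma> \<in> behavior_strategies I1" and \<tau>: "\<tau> \<in> behavior_strategies J2"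
begin

interpretation IT: Ionescu_Tulcea "stage_kernel \<sigma> \<tau> k\<^sub>0" "\<lambda>_. stage_space"
  by (rule Ionescu_Tulcea_stage_kernel[OF \<sigma> \<tau>])

abbreviation "\<mu> \<equiv> play_measure \<sigma> \<tau> k\<^sub>0"

lemma play_measure_eq_lim: "\<mu> = IT.PF.lim"
  by (simp add: play_measure_def)

lemma sets_play_measure [measurable_cong]: "sets \<mu> = sets (PiM UNIV (\<lambda>_. stage_space))"
  by (simp add: play_measure_eq_lim)

lemma play_in_stage_space: "\<omega> \<in> space \<mu> \<Longrightarrow> \<omega> n \<in> space stage_space"
  by (auto simp: play_measure_eq_lim space_PiM)

lemma play_restrict: "\<omega> \<in> space \<mu> \<Longrightarrow> restrict \<omega> {0..<n} \<in> space (\<Pi>\<^sub>M i\<in>{0..<n}. stage_space)"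
  using play_in_stage_space by (auto simp: space_PiM)

interpretation play: prob_space \<mu>
proof (rule prob_space_distrD)
  show "(\<lambda>\<omega>. restrict \<omega> {}) \<in> \<mu> \<rightarrow>\<^sub>M PiM {} (\<lambda>_. stage_space)"
    by (simp add: measurable_cong_sets[OF sets_play_measure refl] measurable_restrict_subset)
  show "prob_space (distr \<mu> (PiM {} (\<lambda>_. stage_space)) (\<lambda>\<omega>. restrict \<omega> {}))"
    unfolding play_measure_eq_lim by (simp only: IT.distr_lim finite.emptyI IT.PF.prob_space_P subset_UNIV)
qed

lemma nn_integral_play_component:
  assumes f: "f \<in> borel_measurable stage_space"
  shows "(\<integral>\<^sup>+\<omega>. f (\<omega> n) \<partial>\<mu>) =
    (\<integral>\<^sup>+\<omega>. \<integral>\<^sup>+k. \<integral>\<^sup>+x. \<integral>\<^sup>+y. f (k, x, y) \<partial>\<tau> n (restrict \<omega> {0..<n}, k)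
      \<partial>\<sigma> n (restrict \<omega> {0..<n}, k) \<partial>next_state k\<^sub>0 n (restrict \<omega> {0..<n}) \<partial>\<mu>)"
proof -
  have "(\<integral>\<^sup>+\<omega>. f (\<omega> n) \<partial>\<mu>) =
      (\<integral>\<^sup>+\<omega>. \<integral>\<^sup>+s. f s \<partial>stage_kernel \<sigma> \<tau> k\<^sub>0 n (restrict \<omega> {0..<n}) \<partial>\<mu>)"
    unfolding play_measure_eq_lim by (rule IT.nn_integral_lim_component[OF f])
  also have "\<dots> = (\<integral>\<^sup>+\<omega>. \<integral>\<^sup>+k. \<integral>\<^sup>+x. \<integral>\<^sup>+y. f (k, x, y) \<partial>\<tau> n (restrict \<omega> {0..<n}, k)
      \<partial>\<sigma> n (restrict \<omega> {0..<n}, k) \<partial>next_state k\<^sub>0 n (restrict \<omega> {0..<n}) \<partial>\<mu>)"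
    by (intro nn_integral_cong nn_integral_stage_kernel[OF \<sigma> \<tau> _ f] play_restrict)
  finally show ?thesis .
qed

lemma prob_space_strategies:
  assumes "\<omega> \<in> space \<mu>"
  shows "prob_space (\<sigma> n (restrict \<omega> {0..<n}, k))" "prob_space (\<tau> n (restrict \<omega> {0..<n}, k))"
  using strategy_in_prob_algebra[OF \<sigma> \<tau> play_restrict[OF assms, of n]]
  by (auto simp: space_prob_algebra)

lemma nn_integral_play_state:
  "(\<integral>\<^sup>+\<omega>. f (fst (\<omega> n)) \<partial>\<mu>) = (\<integral>\<^sup>+\<omega>. \<integral>\<^sup>+k. f k \<partial>next_state k\<^sub>0 n (restrict \<omega> {0..<n}) \<partial>\<mu>)"
proof -
  have "(\<lambda>t. f (fst t)) \<in> borel_measurable stage_space" by measurable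
  from nn_integral_play_component[OF this]
  have "(\<integral>\<^sup>+\<omega>. f (fst (\<omega> n)) \<partial>\<mu>) =
    (\<integral>\<^sup>+\<omega>. \<integral>\<^sup>+k. \<integral>\<^sup>+x. \<integral>\<^sup>+y. f k \<partial>\<tau> n (restrict \<omega> {0..<n}, k)
      \<partial>\<sigma> n (restrict \<omega> {0..<n}, k) \<partial>next_state k\<^sub>0 n (restrict \<omega> {0..<n}) \<partial>\<mu>)" by simp
  also have "\<dots> = (\<integral>\<^sup>+\<omega>. \<integral>\<^sup>+k. f k \<partial>next_state k\<^sub>0 n (restrict \<omega> {0..<n}) \<partial>\<mu>)"
    by (intro nn_integral_cong) (simp add: prob_space_strategies prob_space.emeasure_space_1)
  finally show ?thesis .
qed

lemma measurable_play_component [measurable]: "(\<lambda>\<omega>. \<omega> n) \<in> \<mu> \<rightarrow>\<^sub>M stage_space"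
  by (subst measurable_cong_sets[OF sets_play_measure refl]) (rule measurable_component_singleton, simp)

lemma measurable_play_state [measurable]:
  fixes w :: "state \<Rightarrow> 'a :: topological_space"
  shows "(\<lambda>\<omega>. w (fst (\<omega> n))) \<in> borel_measurable \<mu>"
  by (rule measurable_compose[OF measurable_play_component measurable_stage_state])

lemma integral_play_initial:
  fixes w :: "state \<Rightarrow> real"
  assumes "\<And>k. 0 \<le> w k"
  shows "(\<integral>\<omega>. w (fst (\<omega> 0)) \<partial>\<mu>) = w k\<^sub>0"
proof -
  have "(\<integral>\<^sup>+\<omega>. ennreal (w (fst (\<omega> 0))) \<partial>\<mu>) = ennreal (w k\<^sub>0)"
    using nn_integral_play_state[of "\<lambda>k. ennreal (w k)" 0]
    by (simp add: next_state_def nn_integral_return play.emeasure_space_1)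
  then show ?thesis
    using assms by (subst integral_eq_nn_integral) auto
qed

lemma integral_play_Suc:
  fixes w :: "state \<Rightarrow> real"
  assumes w: "\<And>k. 0 \<le> w k"
  shows "(\<integral>\<omega>. w (fst (\<omega> (Suc n))) \<partial>\<mu>) = (\<integral>\<omega>. continuation w (\<omega> n) \<partial>\<mu>)"
proof -
  have cont: "(\<integral>\<^sup>+k. ennreal (w k) \<partial>next_state k\<^sub>0 (Suc n) (restrict \<omega> {0..<Suc n})) =
      ennreal (continuation w (\<omega> n)) \<and> 0 \<le> continuation w (\<omega> n)" if "\<omega> \<in> space \<mu>" for \<omega>
  proof -
    obtain k x y where \<omega>: "\<omega> n = (k, x, y)" by (cases "\<omega> n") auto
    have xy: "x \<in> I1" "y \<in> J2"
      using play_in_stage_space[OF that, of n] by (auto simp: \<omega> space_stage_space)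
    have "(\<integral>\<^sup>+k. ennreal (w k) \<partial>transition k x y)
        = (\<Sum>k'\<in>UNIV. ennreal (trans_weight k x y k') * ennreal (w k'))"
      unfolding transition_def by (rule nn_integral_point_measure_finite[OF finite_UNIV_state])
    also have "\<dots> = ennreal (continuation w (\<omega> n))"
      using w trans_weight_nonneg[OF xy]
      by (simp add: \<omega> continuation_def ennreal_mult'[symmetric] sum_ennreal)
    finally show ?thesis
      using w trans_weight_nonneg[OF xy] by (auto simp: next_state_def \<omega> continuation_def intro!: sum_nonneg)
  qed
  have "(\<integral>\<^sup>+\<omega>. ennreal (w (fst (\<omega> (Suc n)))) \<partial>\<mu>) = (\<integral>\<^sup>+\<omega>. ennreal (continuation w (\<omega> n)) \<partial>\<mu>)"
    using nn_integral_play_state[of "\<lambda>k. ennreal (w k)" "Suc n"] cont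
    by (simp cong: nn_integral_cong)
  then show ?thesis
    using w cont by (subst (1 2) integral_eq_nn_integral) auto
qed

text \<open>
  Only the pure action prescribed by a stationary strategy is ever played. The opponent is arbitrary,
  so this is read off from the law of the coordinate rather than from the strategies.
\<close>
lemma AE_play_I1:
  assumes s: "\<And>k. s k \<in> I1" and \<sigma>_eq: "\<And>h k. \<sigma> n (h, k) = return (action_space I1) (s k)"
  shows "AE \<omega> in \<mu>. fst (snd (\<omega> n)) = s (fst (\<omega> n))"
proof -
  define f :: "state \<times> real \<times> real \<Rightarrow> ennreal" where
    "f = (\<lambda>t. if fst (snd t) = s (fst t) then 0 else 1)"
  have f: "f \<in> borel_measurable stage_space"
    unfolding f_def by measurable
  have "(\<integral>\<^sup>+y. f (k, x, y) \<partial>\<tau> n (restrict \<omega> {0..<n}, k)) = (if x = s k then 0 else 1)"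
    if "\<omega> \<in> space \<mu>" for \<omega> k x
    using that by (simp add: f_def prob_space_strategies prob_space.emeasure_space_1)
  moreover have "(\<integral>\<^sup>+x. (if x = s k then 0 else 1) \<partial>return (action_space I1) (s k)) = (0::ennreal)" for k
  proof (subst nn_integral_return)
    show "(\<lambda>x. if x = s k then 0 else 1 :: ennreal) \<in> borel_measurable (action_space I1)"
      by (rule measurable_restrict_space1) measurable
  qed (use s in \<open>auto simp: space_restrict_space\<close>)
  ultimately have "(\<integral>\<^sup>+\<omega>. f (\<omega> n) \<partial>\<mu>) = (\<integral>\<^sup>+\<omega>. 0 \<partial>\<mu>)"
    unfolding nn_integral_play_component[OF f] by (intro nn_integral_cong) (simp add: \<sigma>_eq)
  moreover have "(\<lambda>\<omega>. f (\<omega> n)) \<in> borel_measurable \<mu>"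
    using f by measurable
  ultimately have "AE \<omega> in \<mu>. f (\<omega> n) = 0"
    by (simp add: nn_integral_0_iff_AE)
  then show ?thesis
    by eventually_elim (simp add: f_def split: if_splits)
qed

lemma AE_play_J2:
  assumes s: "\<And>k. s k \<in> J2" and \<tau>_eq: "\<And>h k. \<tau> n (h, k) = return (action_space J2) (s k)"
  shows "AE \<omega> in \<mu>. snd (snd (\<omega> n)) = s (fst (\<omega> n))"
proof -
  define f :: "state \<times> real \<times> real \<Rightarrow> ennreal" where
    "f = (\<lambda>t. if snd (snd t) = s (fst t) then 0 else 1)"
  have f: "f \<in> borel_measurable stage_space"
    unfolding f_def by measurable
  have "(\<integral>\<^sup>+y. (if y = s k then 0 else 1) \<partial>return (action_space J2) (s k)) = (0::ennreal)" for k
  proof (subst nn_integral_return)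
    show "(\<lambda>y. if y = s k then 0 else 1 :: ennreal) \<in> borel_measurable (action_space J2)"
      by (rule measurable_restrict_space1) measurable
  qed (use s in \<open>auto simp: space_restrict_space\<close>)
  then have "(\<integral>\<^sup>+\<omega>. f (\<omega> n) \<partial>\<mu>) = 0"
    unfolding nn_integral_play_component[OF f] by (simp add: \<tau>_eq f_def)
  moreover have "(\<lambda>\<omega>. f (\<omega> n)) \<in> borel_measurable \<mu>"
    using f by measurable
  ultimately have "AE \<omega> in \<mu>. f (\<omega> n) = 0"
    by (simp add: nn_integral_0_iff_AE)
  then show ?thesis
    by eventually_elim (simp add: f_def split: if_splits)
qed

lemma integrable_play_bounded:
  fixes f :: "state \<times> real \<times> real \<Rightarrow> real"
  assumes "f \<in> borel_measurable stage_space" "\<And>t. t \<in> space stage_space \<Longrightarrow> \<bar>f t\<bar> \<le> B"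
  shows "integrable \<mu> (\<lambda>\<omega>. f (\<omega> n))"
  using assms play_in_stage_space by (intro play.integrable_const_bound[where B=B]) auto

lemma integrable_play_state:
  fixes w :: "state \<Rightarrow> real"
  shows "integrable \<mu> (\<lambda>\<omega>. w (fst (\<omega> n)))"
proof (rule integrable_play_bounded)
  show "\<bar>w (fst t)\<bar> \<le> (\<Sum>k\<in>UNIV. \<bar>w k\<bar>)" for t :: "state \<times> real \<times> real"
    by (rule member_le_sum) (auto simp: finite_UNIV_state)
qed measurable

lemma discounted_payoff_eq_suminf:
  assumes l: "0 < l" "l \<le> 1"
  shows "discounted_payoff l k\<^sub>0 \<sigma> \<tau> = (\<Sum>n. l * (1 - l) ^ n * (\<integral>\<omega>. stage_payoff (fst (\<omega> n)) \<partial>\<mu>))"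
proof -
  have geo: "summable (\<lambda>n. l * (1 - l) ^ n)"
    using l by (intro summable_mult summable_geometric) auto
  have term_le: "\<bar>l * (1 - l) ^ n * stage_payoff k\<bar> \<le> l * (1 - l) ^ n" for n k
    using l stage_payoff_bounds[of k] by (simp add: abs_mult mult_left_le)
  have "discounted_payoff l k\<^sub>0 \<sigma> \<tau> = (\<Sum>n. \<integral>\<omega>. l * (1 - l) ^ n * stage_payoff (fst (\<omega> n)) \<partial>\<mu>)"
    unfolding discounted_payoff_def
  proof (rule integral_suminf)
    show int: "integrable \<mu> (\<lambda>\<omega>. l * (1 - l) ^ n * stage_payoff (fst (\<omega> n)))" for n
      by (rule integrable_play_state)
    show "AE \<omega> in \<mu>. summable (\<lambda>n. norm (l * (1 - l) ^ n * stage_payoff (fst (\<omega> n))))"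
      using term_le by (intro AE_I2 summable_comparison_test'[OF geo]) simp
    have "(\<integral>\<omega>. norm (l * (1 - l) ^ n * stage_payoff (fst (\<omega> n))) \<partial>\<mu>) \<le> (\<integral>\<omega>. l * (1 - l) ^ n \<partial>\<mu>)" for n
      using term_le int by (intro integral_mono integrable_norm) auto
    then show "summable (\<lambda>n. \<integral>\<omega>. norm (l * (1 - l) ^ n * stage_payoff (fst (\<omega> n))) \<partial>\<mu>)"
      by (intro summable_comparison_test'[OF geo]) (simp add: play.prob_space)
  qed
  then show ?thesis by simp
qed

text \<open>
  The verification principle: the Markov property turns a one-stage inequality along the play into a
  recursion for expectations, which telescopes.
\<close>
lemma
  fixes w :: "state \<Rightarrow> real"
  assumes l: "0 < l" "l \<le> 1" and w: "\<And>k. 0 \<le> w k" "\<And>k. w k \<le> 1"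
  shows subsolution_le_payoff:
      "(\<And>n. AE \<omega> in \<mu>. w (fst (\<omega> n)) \<le> l * stage_payoff (fst (\<omega> n)) + (1 - l) * continuation w (\<omega> n)) \<Longrightarrow>
        w k\<^sub>0 \<le> discounted_payoff l k\<^sub>0 \<sigma> \<tau>"
    and supersolution_ge_payoff:
      "(\<And>n. AE \<omega> in \<mu>. l * stage_payoff (fst (\<omega> n)) + (1 - l) * continuation w (\<omega> n) \<le> w (fst (\<omega> n))) \<Longrightarrow>
        discounted_payoff l k\<^sub>0 \<sigma> \<tau> \<le> w k\<^sub>0"
proof -
  define u where "u n = (\<integral>\<omega>. w (fst (\<omega> n)) \<partial>\<mu>)" for n
  define e where "e n = (\<integral>\<omega>. stage_payoff (fst (\<omega> n)) \<partial>\<mu>)" for n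
  have bound: "\<bar>\<integral>\<omega>. v (fst (\<omega> n)) \<partial>\<mu>\<bar> \<le> 1" if "\<And>k. 0 \<le> v k" "\<And>k. v k \<le> (1::real)" for v n
  proof -
    have "(\<integral>\<omega>. v (fst (\<omega> n)) \<partial>\<mu>) \<le> (\<integral>\<omega>. 1 \<partial>\<mu>)"
      using that by (intro integral_mono integrable_play_state) auto
    then show ?thesis using that by (simp add: play.prob_space)
  qed
  have u_bound: "\<bar>u n\<bar> \<le> 1" and e_bound: "\<bar>e n\<bar> \<le> 1" for n
    unfolding u_def e_def by (rule bound[OF w], rule bound[OF stage_payoff_bounds])
  have u0: "u 0 = w k\<^sub>0"
    unfolding u_def by (rule integral_play_initial[OF w(1)])
  have int_cont: "integrable \<mu> (\<lambda>\<omega>. continuation w (\<omega> n))" for n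
    using continuation_bounds w by (intro integrable_play_bounded) auto
  have int_rhs: "integrable \<mu> (\<lambda>\<omega>. l * stage_payoff (fst (\<omega> n)) + (1 - l) * continuation w (\<omega> n))" for n
    by (intro Bochner_Integration.integrable_add integrable_mult_right int_cont integrable_play_state)
  have rhs: "(\<integral>\<omega>. l * stage_payoff (fst (\<omega> n)) + (1 - l) * continuation w (\<omega> n) \<partial>\<mu>)
      = l * e n + (1 - l) * u (Suc n)" for n
    using integral_play_Suc[of w n, OF w(1)] unfolding u_def e_def
    by (simp add: Bochner_Integration.integral_add int_cont integrable_play_state)
  have payoff: "discounted_payoff l k\<^sub>0 \<sigma> \<tau> = (\<Sum>n. l * (1 - l) ^ n * e n)"
    unfolding e_def by (rule discounted_payoff_eq_suminf[OF l])
  show "w k\<^sub>0 \<le> discounted_payoff l k\<^sub>0 \<sigma> \<tau>"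
    if "\<And>n. AE \<omega> in \<mu>. w (fst (\<omega> n)) \<le> l * stage_payoff (fst (\<omega> n)) + (1 - l) * continuation w (\<omega> n)"
  proof -
    have "u n \<le> l * e n + (1 - l) * u (Suc n)" for n
      unfolding rhs[symmetric] unfolding u_def
      by (intro integral_mono_AE integrable_play_state int_rhs that)
    from discounted_telescope_le(2)[of l u 1 e, OF l u_bound e_bound this] show ?thesis
      by (simp add: payoff u0)
  qed
  show "discounted_payoff l k\<^sub>0 \<sigma> \<tau> \<le> w k\<^sub>0"
    if "\<And>n. AE \<omega> in \<mu>. l * stage_payoff (fst (\<omega> n)) + (1 - l) * continuation w (\<omega> n) \<le> w (fst (\<omega> n))"
  proof -
    have "l * e n + (1 - l) * u (Suc n) \<le> u n" for n
      unfolding rhs[symmetric] unfolding u_def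
      by (intro integral_mono_AE integrable_play_state int_rhs that)
    then have step: "- u n \<le> l * (- e n) + (1 - l) * (- u (Suc n))" for n
      by (simp add: algebra_simps)
    have "- u 0 \<le> (\<Sum>n. l * (1 - l) ^ n * (- e n))"
      by (rule discounted_telescope_le(2)[of l "\<lambda>n. - u n" 1 "\<lambda>n. - e n", OF l _ _ step])
        (use u_bound e_bound in auto)
    moreover have "summable (\<lambda>n. l * (1 - l) ^ n * (- e n))"
      by (rule discounted_telescope_le(1)[of l "\<lambda>n. - u n" 1 "\<lambda>n. - e n", OF l _ _ step])
        (use u_bound e_bound in auto)
    then have "summable (\<lambda>n. l * (1 - l) ^ n * e n)"
      by (simp add: summable_minus_iff)
    ultimately show ?thesis by (simp add: payoff u0 suminf_minus)
  qed
qed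

lemma discounted_payoff_bounds:
  assumes l: "0 < l" "l \<le> 1"
  shows "0 \<le> discounted_payoff l k\<^sub>0 \<sigma> \<tau>" "discounted_payoff l k\<^sub>0 \<sigma> \<tau> \<le> 1"
proof -
  \<comment> \<open>The constants 0 and 1 are a sub- and a supersolution for every pair of strategies.\<close>
  have cont: "continuation (\<lambda>_. 0) t = 0" "continuation (\<lambda>_. 1) t = 1" for t
    by (cases t; cases "fst t"; simp add: continuation_def UNIV_state)+
  show "0 \<le> discounted_payoff l k\<^sub>0 \<sigma> \<tau>"
    using subsolution_le_payoff[OF l, of "\<lambda>_. 0"] l stage_payoff_bounds by (simp add: cont)
  have "l * stage_payoff k + (1 - l) \<le> 1" for k
    using l stage_payoff_bounds[of k] by (simp add: mult_left_le)
  then show "discounted_payoff l k\<^sub>0 \<sigma> \<tau> \<le> 1"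
    using supersolution_ge_payoff[OF l, of "\<lambda>_. 1"] by (simp add: cont)
qed

end

section \<open>Optimal stationary strategies\<close>

definition stationary :: "real set \<Rightarrow> (state \<Rightarrow> real) \<Rightarrow> strategy" where
  "stationary A s = (\<lambda>n (h, k). return (action_space A) (s k))"

lemma stationary_in_behavior_strategies:
  assumes "\<And>k. s k \<in> A"
  shows "stationary A s \<in> behavior_strategies A"
proof -
  have "return (action_space A) (s k) \<in> space (prob_algebra (action_space A))" for k
    using assms[of k] by (auto simp: space_prob_algebra prob_space_return space_restrict_space)
  then have "(\<lambda>k. return (action_space A) (s k)) \<in> state_space \<rightarrow>\<^sub>M prob_algebra (action_space A)"
    by simp
  from measurable_compose[OF measurable_snd this] show ?thesis
    by (auto simp add: behavior_strategies_def stationary_def history_space_def case_prod_beta')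
qed

text \<open>
  Suprema and infima of real families obey the usual order rules only for bounded families, so the
  bounds $0$ and $1$ on the payoff are used for every pair of strategies.
\<close>
lemma is_value_if_saddle_point:
  assumes l: "0 < l" "l \<le> 1"
    and \<sigma>: "\<sigma> \<in> behavior_strategies I1" and \<tau>: "\<tau> \<in> behavior_strategies J2"
    and lower: "\<And>\<tau>'. \<tau>' \<in> behavior_strategies J2 \<Longrightarrow> v \<le> discounted_payoff l k \<sigma> \<tau>'"
    and upper: "\<And>\<sigma>'. \<sigma>' \<in> behavior_strategies I1 \<Longrightarrow> discounted_payoff l k \<sigma>' \<tau> \<le> v"
  shows "is_value l k v"
proof -
  have below: "bdd_below (discounted_payoff l k \<sigma>' ` behavior_strategies J2)"
    if "\<sigma>' \<in> behavior_strategies I1" for \<sigma>'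
    using discounted_payoff_bounds[OF that _ l] by (intro bdd_belowI2[of _ 0]) auto
  have above: "bdd_above ((\<lambda>\<sigma>'. discounted_payoff l k \<sigma>' \<tau>') ` behavior_strategies I1)"
    if "\<tau>' \<in> behavior_strategies J2" for \<tau>'
    using discounted_payoff_bounds[OF _ that l] by (intro bdd_aboveI2[of _ _ 1]) auto
  have inf_le: "(INF \<tau>'\<in>behavior_strategies J2. discounted_payoff l k \<sigma>' \<tau>') \<le> v"
    if "\<sigma>' \<in> behavior_strategies I1" for \<sigma>'
    using cINF_lower[OF below[OF that] \<tau>] upper[OF that] by linarith
  have sup_ge: "v \<le> (SUP \<sigma>'\<in>behavior_strategies I1. discounted_payoff l k \<sigma>' \<tau>')"
    if "\<tau>' \<in> behavior_strategies J2" for \<tau>'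
    using cSUP_upper[OF \<sigma> above[OF that]] lower[OF that] by linarith
  have "(SUP \<sigma>'\<in>behavior_strategies I1. INF \<tau>'\<in>behavior_strategies J2. discounted_payoff l k \<sigma>' \<tau>') = v"
  proof (rule antisym)
    show "(SUP \<sigma>'\<in>behavior_strategies I1. INF \<tau>'\<in>behavior_strategies J2. discounted_payoff l k \<sigma>' \<tau>') \<le> v"
      using \<sigma> inf_le by (intro cSUP_least) auto
    show "v \<le> (SUP \<sigma>'\<in>behavior_strategies I1. INF \<tau>'\<in>behavior_strategies J2. discounted_payoff l k \<sigma>' \<tau>')"
      using \<tau> lower inf_le by (intro cSUP_upper2[OF _ \<sigma>] cINF_greatest bdd_aboveI2) auto
  qed
  moreover have "(INF \<tau>'\<in>behavior_strategies J2. SUP \<sigma>'\<in>behavior_strategies I1. discounted_payoff l k \<sigma>' \<tau>') = v"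
  proof (rule antisym)
    show "v \<le> (INF \<tau>'\<in>behavior_strategies J2. SUP \<sigma>'\<in>behavior_strategies I1. discounted_payoff l k \<sigma>' \<tau>')"
      using \<tau> sup_ge by (intro cINF_greatest) auto
    show "(INF \<tau>'\<in>behavior_strategies J2. SUP \<sigma>'\<in>behavior_strategies I1. discounted_payoff l k \<sigma>' \<tau>') \<le> v"
      using \<sigma> upper sup_ge by (intro cINF_lower2[OF _ \<tau>] cSUP_least bdd_belowI2) auto
  qed
  ultimately show ?thesis by (simp add: is_value_def)
qed

fun state_value :: "real \<Rightarrow> real \<Rightarrow> state \<Rightarrow> real" where
  "state_value a b OneStar = 1"
| "state_value a b One = a"
| "state_value a b ZeroStar = 0"
| "state_value a b Zero = b"

lemma one_shot_payoff:
  "l * stage_payoff One + (1 - l) * continuation (state_value a b) (One, x, y) = shapley_One l a b y"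
  "l * stage_payoff Zero + (1 - l) * continuation (state_value a b) (Zero, x, y) = shapley_Zero l a b x"
  "l * stage_payoff OneStar + (1 - l) * continuation (state_value a b) (OneStar, x, y) = 1"
  "l * stage_payoff ZeroStar + (1 - l) * continuation (state_value a b) (ZeroStar, x, y) = 0"
  by (simp_all add: continuation_def UNIV_state shapley_One_def shapley_Zero_def algebra_simps)

text \<open>
  Each player can repeat one action in every state, because it influences the transition only in the
  single nonabsorbing state which that player controls.
\<close>
lemma is_value_if_shapley_solution:
  assumes l: "0 < l" "l \<le> 1" and S: "shapley_solution l a b x y"
  shows "is_value l One a"
proof -
  let ?w = "state_value a b"
  have ab: "0 \<le> a" "a \<le> 1" "0 \<le> b" "b \<le> 1" and x: "x \<in> I1" and y: "y \<in> J2"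
    using S by (auto simp: shapley_solution_def)
  have w: "0 \<le> ?w k" "?w k \<le> 1" for k
    using ab by (cases k; simp)+
  have "0 \<in> I1" "0 \<in> J2" by (auto simp: I1_def J2_def)
  with x y have \<sigma>: "stationary I1 (\<lambda>_. x) \<in> behavior_strategies I1"
    and \<tau>: "stationary J2 (\<lambda>_. y) \<in> behavior_strategies J2"
    by (auto intro!: stationary_in_behavior_strategies)
  show ?thesis
  proof (rule is_value_if_saddle_point[OF l \<sigma> \<tau>])
    fix \<tau>' assume \<tau>': "\<tau>' \<in> behavior_strategies J2"
    have "?w One \<le> discounted_payoff l One (stationary I1 (\<lambda>_. x)) \<tau>'"
    proof (rule subsolution_le_payoff[OF \<sigma> \<tau>' l w])
      fix n
      have "AE \<omega> in play_measure (stationary I1 (\<lambda>_. x)) \<tau>' One. fst (snd (\<omega> n)) = x"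
        using x by (intro AE_play_I1[OF \<sigma> \<tau>']) (auto simp: stationary_def)
      then show "AE \<omega> in play_measure (stationary I1 (\<lambda>_. x)) \<tau>' One.
          ?w (fst (\<omega> n)) \<le> l * stage_payoff (fst (\<omega> n)) + (1 - l) * continuation ?w (\<omega> n)"
        using AE_space
      proof eventually_elim
        fix \<omega> :: "nat \<Rightarrow> state \<times> real \<times> real"
        assume x_eq: "fst (snd (\<omega> n)) = x"
          and \<omega>: "\<omega> \<in> space (play_measure (stationary I1 (\<lambda>_. x)) \<tau>' One)"
        then obtain k y' where eq: "\<omega> n = (k, x, y')" by (cases "\<omega> n") auto
        have "y' \<in> J2"
          using play_in_stage_space[OF \<sigma> \<tau>' \<omega>, of n] by (simp add: eq space_stage_space)
        with S show "?w (fst (\<omega> n)) \<le> l * stage_payoff (fst (\<omega> n)) + (1 - l) * continuation ?w (\<omega> n)"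
          unfolding eq fst_conv
          by (cases k; simp only: one_shot_payoff state_value.simps) (auto simp: shapley_solution_def)
      qed
    qed
    then show "a \<le> discounted_payoff l One (stationary I1 (\<lambda>_. x)) \<tau>'" by simp
  next
    fix \<sigma>' assume \<sigma>': "\<sigma>' \<in> behavior_strategies I1"
    have "discounted_payoff l One \<sigma>' (stationary J2 (\<lambda>_. y)) \<le> ?w One"
    proof (rule supersolution_ge_payoff[OF \<sigma>' \<tau> l w])
      fix n
      have "AE \<omega> in play_measure \<sigma>' (stationary J2 (\<lambda>_. y)) One. snd (snd (\<omega> n)) = y"
        using y by (intro AE_play_J2[OF \<sigma>' \<tau>]) (auto simp: stationary_def)
      then show "AE \<omega> in play_measure \<sigma>' (stationary J2 (\<lambda>_. y)) One.
          l * stage_payoff (fst (\<omega> n)) + (1 - l) * continuation ?w (\<omega> n) \<le> ?w (fst (\<omega> n))"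
        using AE_space
      proof eventually_elim
        fix \<omega> :: "nat \<Rightarrow> state \<times> real \<times> real"
        assume y_eq: "snd (snd (\<omega> n)) = y"
          and \<omega>: "\<omega> \<in> space (play_measure \<sigma>' (stationary J2 (\<lambda>_. y)) One)"
        then obtain k x' where eq: "\<omega> n = (k, x', y)" by (cases "\<omega> n") auto
        have "x' \<in> I1"
          using play_in_stage_space[OF \<sigma>' \<tau> \<omega>, of n] by (simp add: eq space_stage_space)
        with S show "l * stage_payoff (fst (\<omega> n)) + (1 - l) * continuation ?w (\<omega> n) \<le> ?w (fst (\<omega> n))"
          unfolding eq fst_conv
          by (cases k; simp only: one_shot_payoff state_value.simps) (auto simp: shapley_solution_def)
      qed
    qed
    then show "discounted_payoff l One \<sigma>' (stationary J2 (\<lambda>_. y)) \<le> a" by simp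
  qed
qed

lemma game_value_eq: "is_value l k v \<Longrightarrow> game_value l k = v"
  unfolding game_value_def by (rule the_equality) (simp_all add: is_value_def)

lemma game_value_shapley_solution:
  assumes "0 < l" "l \<le> 1"
  obtains b x y where "shapley_solution l (game_value l One) b x y"
proof -
  obtain a b x y where S: "shapley_solution l a b x y"
    using shapley_solution_exists[OF assms] .
  with game_value_eq[OF is_value_if_shapley_solution[OF assms S]] that show thesis by simp
qed

section \<open>Vanishing discount factor\<close>

lemma normalized_gap:
  assumes l: "0 < l" "l < 1" and S: "shapley_solution l a b x y"
  shows "(a - b) / sqrt l = 2 * sqrt (a * b / (1 - l))"
proof -
  note quad = shapley_solution_quadratic[OF l(1) less_imp_le[OF l(2)] S]
  have "0 \<le> a" "0 \<le> b" using S by (auto simp: shapley_solution_def)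
  have "((a - b) / sqrt l)\<^sup>2 = (a - b)\<^sup>2 / l"
    using l by (simp add: power_divide)
  also have "\<dots> = 4 * (a * b / (1 - l))"
    using quad(2) l by (simp add: field_simps)
  finally have "(a - b) / sqrt l = sqrt (4 * (a * b / (1 - l)))"
    using quad(1) l by (intro real_sqrt_unique[symmetric]) auto
  then show ?thesis by (simp only: real_sqrt_mult) simp
qed

text \<open>
  At the scale $y = z \sqrt l$ both terms of the one-shot payoff have order $l$, so the Shapley equation
  at \<^const>\<open>One\<close> survives division by $l$ in the limit.
\<close>
lemma shapley_One_normalized:
  assumes l: "0 < l"
  shows "shapley_One l a b (z * sqrt l) - a =
    l * ((1 - a) - (1 - l) * (z * ((a - b) / sqrt l) - z\<^sup>2 * (1 - b)))"
proof -
  have eq: "z * sqrt l * (a - b) = l * (z * ((a - b) / sqrt l))"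
    using l real_sqrt_mult_self[of l] by (simp add: field_simps)
  have "shapley_One l a b (z * sqrt l) - a
      = l * (1 - a) - (1 - l) * (z * sqrt l * (a - b) - z\<^sup>2 * l * (1 - b))"
    using l by (simp add: shapley_One_def power_mult_distrib algebra_simps)
  also have "\<dots> = l * ((1 - a) - (1 - l) * (z * ((a - b) / sqrt l) - z\<^sup>2 * (1 - b)))"
    unfolding eq by (simp add: algebra_simps)
  finally show ?thesis .
qed

text \<open>
  Values along a sequence of discount factors tending to $0$, assuming that those at \<^const>\<open>One\<close>
  converge to $L$; $d$ is the normalized gap between the two states.
\<close>
context
  fixes L :: real and l a b d x y :: "nat \<Rightarrow> real"
  assumes l: "\<And>m. 0 < l m" "\<And>m. l m < 1" "l \<longlonglongrightarrow> 0"
    and S: "\<And>m. shapley_solution (l m) (a m) (b m) (x m) (y m)"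
    and a: "a \<longlonglongrightarrow> L"
    and d: "d = (\<lambda>m. (a m - b m) / sqrt (l m))"
begin

lemma limit_other_state: "b \<longlonglongrightarrow> L"
proof -
  have ab: "0 \<le> a m" "a m \<le> 1" "0 \<le> b m" "b m \<le> 1" for m
    using S[of m] by (auto simp: shapley_solution_def)
  have "(\<lambda>m. 4 * l m / (1 - l m)) \<longlonglongrightarrow> 4 * 0 / (1 - 0)"
    using l(3) by (intro tendsto_intros) auto
  then have "(\<lambda>m. 4 * l m / (1 - l m)) \<longlonglongrightarrow> 0" by simp
  then have "(\<lambda>m. (a m - b m)\<^sup>2) \<longlonglongrightarrow> 0"
  proof (rule Lim_null_comparison[rotated], intro always_eventually allI)
    fix m
    have "(a m - b m)\<^sup>2 = 4 * l m / (1 - l m) * (a m * b m)"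
      using shapley_solution_quadratic(2)[OF l(1) less_imp_le[OF l(2)] S, of m] l(2)[of m]
      by (simp add: field_simps)
    also have "\<dots> \<le> 4 * l m / (1 - l m) * 1"
      using ab[of m] l(1,2)[of m] by (intro mult_left_mono mult_le_one) auto
    finally show "norm ((a m - b m)\<^sup>2) \<le> 4 * l m / (1 - l m)" by simp
  qed
  then have "(\<lambda>m. a m - b m) \<longlonglongrightarrow> 0" by simp
  from tendsto_diff[OF a this] show ?thesis by simp
qed

lemma limit_normalized_gap: "d \<longlonglongrightarrow> 2 * L"
proof -
  have "0 \<le> L"
    using a S by (intro LIMSEQ_le_const[OF a]) (auto simp: shapley_solution_def)
  have "(\<lambda>m. 2 * sqrt (a m * b m / (1 - l m))) \<longlonglongrightarrow> 2 * sqrt (L * L / (1 - 0))"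
    using l(3) a limit_other_state by (intro tendsto_intros) auto
  also have "(\<lambda>m. 2 * sqrt (a m * b m / (1 - l m))) = d"
    unfolding d using normalized_gap[OF l(1,2) S] by simp
  finally show ?thesis using \<open>0 \<le> L\<close> by simp
qed

text \<open>
  Player 2 can use $z = 1$, which gives $1 - L \ge 2 L - (1 - L)$.
\<close>
lemma limit_le_half:
  assumes sqrt_l: "\<And>m. sqrt (l m) \<in> J2"
  shows "L \<le> 1 / 2"
proof -
  have "(1 - l m) * (d m - (1 - b m)) \<le> 1 - a m" for m
  proof -
    have "0 \<le> shapley_One (l m) (a m) (b m) (1 * sqrt (l m)) - a m"
      using S[of m] sqrt_l[of m] by (simp add: shapley_solution_def)
    then show ?thesis
      unfolding shapley_One_normalized[OF l(1)] using l(1)[of m]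
      by (simp add: zero_le_mult_iff d)
  qed
  moreover have "(\<lambda>m. (1 - l m) * (d m - (1 - b m))) \<longlonglongrightarrow> (1 - 0) * (2 * L - (1 - L))"
    using l(3) limit_other_state limit_normalized_gap by (intro tendsto_intros)
  moreover have "(\<lambda>m. 1 - a m) \<longlonglongrightarrow> 1 - L"
    using a by (intro tendsto_intros)
  ultimately have "(1 - 0) * (2 * L - (1 - L)) \<le> 1 - L"
    by (intro LIMSEQ_le) auto
  then show ?thesis by simp
qed

text \<open>
  Outside the interval between $1/2$ and $2$ one has $(z - 1/2)(z - 2) \ge 0$, that is,
  $z \le \frac25 (z^2 + 1)$. Hence $z d - z^2 (1 - b) \le \frac25 d - z^2 ((1 - b) - \frac25 d)$.
  For $L \le 1/2$ the last bracket has the positive limit $(1 - L) - \frac45 L$, so the equation at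
  \<^const>\<open>One\<close> yields $1 - L \le \frac45 L$, a contradiction.
\<close>
lemma limit_gt_half:
  assumes gap: "\<And>m z. z * sqrt (l m) \<in> J2 \<Longrightarrow> z \<le> 1 / 2 \<or> 2 \<le> z"
  shows "1 / 2 < L"
proof (rule ccontr)
  assume "\<not> 1 / 2 < L"
  then have "0 < (1 - L) - 2 / 5 * (2 * L)" by simp
  moreover have "(\<lambda>m. (1 - b m) - 2 / 5 * d m) \<longlonglongrightarrow> (1 - L) - 2 / 5 * (2 * L)"
    using limit_other_state limit_normalized_gap by (intro tendsto_intros)
  ultimately have "\<forall>\<^sub>F m in sequentially. 0 < (1 - b m) - 2 / 5 * d m"
    by (rule order_tendstoD(1)[rotated])
  then have "\<forall>\<^sub>F m in sequentially. 1 - a m \<le> (1 - l m) * (2 / 5 * d m)"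
  proof eventually_elim
    fix m assume neg: "0 < (1 - b m) - 2 / 5 * d m"
    define z where "z = y m / sqrt (l m)"
    have y_eq: "y m = z * sqrt (l m)" using l(1)[of m] by (simp add: z_def)
    have y: "y m \<in> J2" and reply: "shapley_One (l m) (a m) (b m) (y m) - a m = 0"
      using S[of m] by (auto simp: shapley_solution_def)
    have "0 \<le> (z - 1 / 2) * (z - 2)"
      using gap[of z m] y by (auto simp: y_eq zero_le_mult_iff)
    then have z: "z \<le> 2 / 5 * (z\<^sup>2 + 1)"
      by (simp add: power2_eq_square field_simps)
    have d0: "0 \<le> d m"
      using shapley_solution_quadratic(1)[OF l(1) less_imp_le[OF l(2)] S, of m] l(1)[of m] by (simp add: d)
    have "z * d m - z\<^sup>2 * (1 - b m) \<le> 2 / 5 * (z\<^sup>2 + 1) * d m - z\<^sup>2 * (1 - b m)"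
      using mult_right_mono[OF z d0] by simp
    also have "\<dots> = 2 / 5 * d m - z\<^sup>2 * ((1 - b m) - 2 / 5 * d m)"
      by (simp add: algebra_simps)
    also have "\<dots> \<le> 2 / 5 * d m"
      using neg by simp
    finally have "(1 - l m) * (z * d m - z\<^sup>2 * (1 - b m)) \<le> (1 - l m) * (2 / 5 * d m)"
      using l(2)[of m] by (intro mult_left_mono) auto
    moreover have "1 - a m = (1 - l m) * (z * d m - z\<^sup>2 * (1 - b m))"
      using reply l(1)[of m] unfolding y_eq shapley_One_normalized[OF l(1)] by (simp add: d)
    ultimately show "1 - a m \<le> (1 - l m) * (2 / 5 * d m)" by simp
  qed
  moreover have "(\<lambda>m. (1 - l m) * (2 / 5 * d m)) \<longlonglongrightarrow> (1 - 0) * (2 / 5 * (2 * L))"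
    using l(3) limit_normalized_gap by (intro tendsto_intros)
  moreover have "(\<lambda>m. 1 - a m) \<longlonglongrightarrow> 1 - L"
    using a by (intro tendsto_intros)
  ultimately have "1 - L \<le> (1 - 0) * (2 / 5 * (2 * L))"
    by (intro tendsto_le[OF sequentially_bot])
  with \<open>\<not> 1 / 2 < L\<close> show False by simp
qed

end

lemma J2_avoids_double_power:
  assumes "z * (2 / 4 ^ m) \<in> J2"
  shows "z \<le> 1 / 2 \<or> 2 \<le> z"
proof -
  from assms consider "z * (2 / 4 ^ m) = 0" | k where "z * (2 / 4 ^ m) = 1 / 4 ^ k"
    by (auto simp: J2_def)
  then show ?thesis
  proof cases
    case 2
    then have z: "z = 4 ^ m / (2 * 4 ^ k)" by (simp add: field_simps)
    show ?thesis
    proof (cases "m \<le> k")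
      case True
      then have "(4::real) ^ m \<le> 4 ^ k" by (intro power_increasing) auto
      then show ?thesis by (simp add: z)
    next
      case False
      then have "(4::real) ^ Suc k \<le> 4 ^ m" by (intro power_increasing) auto
      then show ?thesis by (simp add: z field_simps)
    qed
  qed simp
qed

theorem mainTheorem5:
  shows "(\<forall>l. 0 < l \<and> l \<le> 1 \<longrightarrow> (\<exists>v. is_value l One v)) \<and>
         \<not> (\<exists>L::real. ((\<lambda>l. game_value l One) \<longlongrightarrow> L) (at_right 0))"
proof (intro conjI allI impI)
  fix l :: real assume l: "0 < l \<and> l \<le> 1"
  then obtain a b x y where "shapley_solution l a b x y"
    using shapley_solution_exists by blast
  with l show "\<exists>v. is_value l One v"
    using is_value_if_shapley_solution by blast
next
  show "\<not> (\<exists>L::real. ((\<lambda>l. game_value l One) \<longlongrightarrow> L) (at_right 0))"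
  proof
    assume "\<exists>L::real. ((\<lambda>l. game_value l One) \<longlongrightarrow> L) (at_right 0)"
    then obtain L where L: "((\<lambda>l. game_value l One) \<longlongrightarrow> L) (at_right 0)" ..
    have lim: "(\<lambda>m. game_value (l m) One) \<longlonglongrightarrow> L"
      if "\<And>m. 0 < l m" "l \<longlonglongrightarrow> 0" for l :: "nat \<Rightarrow> real"
      using that by (intro filterlim_compose[OF L] tendsto_imp_filterlim_at_right) auto
    have "\<exists>b x y. 0 < l \<and> l < 1 \<longrightarrow> shapley_solution l (game_value l One) b x y" for l
      using game_value_shapley_solution[of l] by (metis less_imp_le)
    then obtain b x y where S:
      "\<And>l. 0 < l \<Longrightarrow> l < 1 \<Longrightarrow> shapley_solution l (game_value l One) (b l) (x l) (y l)"
      by metis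
    \<comment> \<open>Starting at the exponent 1 keeps both $p^2$ and $(2p)^2$ below 1.\<close>
    define p where "p m = (1 / 4 ^ Suc m :: real)" for m :: nat
    have p: "0 < p m" "p m \<le> 1 / 4" for m
      by (auto simp: p_def power_le_one field_simps)
    have p_lim: "p \<longlonglongrightarrow> 0"
      using LIMSEQ_Suc[OF LIMSEQ_realpow_zero[of "1/4::real"]]
      by (simp add: p_def[abs_def] power_one_over)
    have "(\<lambda>m. 2 * p m) \<longlonglongrightarrow> 2 * 0"
      using p_lim by (intro tendsto_intros)
    with p_lim have l_lim: "(\<lambda>m. (p m)\<^sup>2) \<longlonglongrightarrow> 0" "(\<lambda>m. (2 * p m)\<^sup>2) \<longlonglongrightarrow> 0"
      by (simp_all add: tendsto_null_power)
    have l: "0 < (p m)\<^sup>2" "(p m)\<^sup>2 < 1" "0 < (2 * p m)\<^sup>2" "(2 * p m)\<^sup>2 < 1" for m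
      unfolding abs_square_less_1 zero_less_power2 using p[of m] by auto
    have "sqrt ((p m)\<^sup>2) \<in> J2" for m
    proof -
      have "sqrt ((p m)\<^sup>2) = 1 / 4 ^ Suc m" using p(1)[of m] by (simp add: p_def)
      then show ?thesis unfolding J2_def by blast
    qed
    then have "L \<le> 1 / 2"
      by (rule limit_le_half[OF l(1,2) l_lim(1) S[OF l(1,2)] lim[OF l(1) l_lim(1)] refl])
    moreover have "z \<le> 1 / 2 \<or> 2 \<le> z" if "z * sqrt ((2 * p m)\<^sup>2) \<in> J2" for m z
    proof (rule J2_avoids_double_power)
      have "sqrt ((2 * p m)\<^sup>2) = 2 / 4 ^ Suc m" using p(1)[of m] by (simp add: p_def)
      with that show "z * (2 / 4 ^ Suc m) \<in> J2" by simp
    qed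
    then have "1 / 2 < L"
      by (rule limit_gt_half[OF l(3,4) l_lim(2) S[OF l(3,4)] lim[OF l(3) l_lim(2)] refl])
    ultimately show False by simp
  qed
qed

end
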